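(* Let $\mathbb F$ be a field of characteristic $2$, let $L$ and $M$ be restricted Lie algebras over $\mathbb F$ and let $\varphi:L\to M$ be a restricted morphism. For all $n\in\mathbb N$, the maps $\mathfrak d^n_{*_2}:\mathfrak C^n_{*_2}(\varphi,\varphi)\to\mathfrak C^{n+1}_{*_2}(\varphi,\varphi)$ are well defined and satisfy $\mathfrak d^{n+1}_{*_2}\circ\mathfrak d^n_{*_2}=0$.
   Context: A restricted Lie algebra in characteristic $2$ is a Lie algebra $L$ (with $[x,x]=0$) with a map $(\cdot)^{[2]}:L\to L$ such that $(\lambda x)^{[2]}=\lambda^2x^{[2]}$, $[x,y^{[2]}]=[[x,y],y]$, $(x+y)^{[2]}=x^{[2]}+y^{[2]}+[x,y]$. A restricted morphism is a Lie morphism with $\varphi(x^{[2]})=\varphi(x)^{[2]}$. A restricted $L$-module is an $L$-module $V$ with $x^{[2]}\cdot m=x\cdot(x\cdot m)$. $L$ and $M$ act on themselves by the adjoint action and $M$ is a restricted $L$-module via $x\cdot m=[\varphi(x),m]_M$. For a restricted $L$-module $V$: $C^n_{CE}(L,V)$ is the space of alternating $n$-linear maps $L^n\to V$ ($C^0_{CE}(L,V)=V$), with $d^n_{CE}\psi(x_1,\dots,x_{n+1})=\sum_{i<j}\psi([x_i,x_j],x_1,\dots,\hat x_i,\dots,\hat x_j,\dots,x_{n+1})+\sum_i x_i\cdot\psi(x_1,\dots,\hat x_i,\dots,x_{n+1})$. $C^0_{*_2}(L,V)=V$, $C^1_{*_2}(L,V)=\mathrm{Hom}_{\mathbb F}(L,V)$;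 for $n\ge2$, $C^n_{*_2}(L,V)$ is the set of pairs $(\psi,\omega)$ with $\psi\in C^n_{CE}(L,V)$ and $\omega(x,z_2,\dots,z_{n-1})\in V$ multilinear alternating in $z_2,\dots,z_{n-1}$, with $\omega(\lambda x,z_2,\dots)=\lambda^2\omega(x,z_2,\dots)$ and $\omega(x+y,z_2,\dots,z_{n-1})=\omega(x,z_2,\dots,z_{n-1})+\omega(y,z_2,\dots,z_{n-1})+\psi(x,y,z_2,\dots,z_{n-1})$. For $\psi\in C^1_{*_2}(L,V)$, $\delta^1\psi(x)=\psi(x^{[2]})+x\cdot\psi(x)$. For $(\psi,\omega)\in C^n_{*_2}(L,V)$, $n\ge2$, $$\delta^n\omega(x,z_2,\dots,z_n)=x\cdot\psi(x,z_2,\dots,z_n)+\sum_{i=2}^nz_i\cdot\omega(x,z_2,\dots,\hat z_i,\dots,z_n)+\psi(x^{[2]},z_2,\dots,z_n)+\sum_{i=2}^n\psi([x,z_i],x,z_2,\dots,\hat z_i,\dots,z_n)+\sum_{2\le i<j\le n}\omega(x,[z_i,z_j],z_2,\dots,\hat z_i,\dots,\hat z_j,\dots,z_n).$$ Deformation complex of $\varphi$: $\mathfrak C^0_{*_2}(\varphi,\varphi)=0$ and, for $n\ge1$, $\mathfrak C^n_{*_2}(\varphi,\varphi)=C^n_{*_2}(L,L)\times C^n_{*_2}(M,M)\times C^{n-1}_{*_2}(L,M)$. The differentials are $\mathfrak d^0_{*_2}=0$, $$\mathfrak d^1_{*_2}(\mu,\nu,m)=\big((d^1_{CE}\mu,\delta^1\mu),(d^1_{CE}\nu,\delta^1\nu),\alpha_{\mu,\nu}(m)\big),$$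 $$\mathfrak d^2_{*_2}\big((\mu,\omega),(\nu,\epsilon),\theta\big)=\big((d^2_{CE}\mu,\delta^2\omega),(d^2_{CE}\nu,\delta^2\epsilon),(\alpha_{\mu,\nu}(\theta),\beta_{\omega,\epsilon}(\theta))\big),$$ and for $n\ge3$ $$\mathfrak d^n_{*_2}\big((\mu,\omega),(\nu,\epsilon),(\theta,\rho)\big)=\big((d^n_{CE}\mu,\delta^n\omega),(d^n_{CE}\nu,\delta^n\epsilon),(\alpha_{\mu,\nu}(\theta),\beta_{\omega,\epsilon}(\rho))\big),$$ where $\alpha_{\mu,\nu}(\theta)=\varphi\circ\mu+\nu\circ\varphi^{\otimes n}+d^{n-1}_{CE}\theta$ and $\beta_{\omega,\epsilon}(\rho)=\varphi\circ\omega+\epsilon\circ\varphi^{\otimes(n-1)}+\delta^{n-1}\rho$ (for $n=2$, $\beta_{\omega,\epsilon}(\theta)=\varphi\circ\omega+\epsilon\circ\varphi+\delta^1\theta$; $\delta^{n-1}\rho$ for $n\ge 3$ is computed from the pair $(\theta,\rho)$; $\varphi^{\otimes k}$ means applying $\varphi$ to each of the $k$ arguments). *)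

theory Defs
  imports Complex_Main "HOL-Library.Function_Algebras" "HOL-Library.Product_Plus"
begin

text \<open>
  The underlying space of a Lie algebra or of a module is a whole type of class
  \<^class>\<open>ab_group_add\<close>; the scalar multiplication is part of the structure.
\<close>

record ('k, 'a) restricted_lie =
  scal :: "'k \<Rightarrow> 'a \<Rightarrow> 'a"
  brk :: "'a \<Rightarrow> 'a \<Rightarrow> 'a"
  sq :: "'a \<Rightarrow> 'a"

locale lie_algebra = vector_space "scal L"
  for L :: "('k::field, 'a::ab_group_add) restricted_lie" +
  assumes brk_linear_left: "Vector_Spaces.linear (scal L) (scal L) (\<lambda>x. brk L x y)"
    and brk_linear_right: "Vector_Spaces.linear (scal L) (scal L) (\<lambda>y. brk L x y)"
    and brk_self: "brk L x x = 0"
    and jacobi: "brk L x (brk L y z) + brk L y (brk L z x) + brk L z (brk L x y) = 0"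

text \<open>These are the axioms for the case of characteristic 2, which is not itself assumed here.\<close>

locale restricted_lie_algebra = lie_algebra L
  for L :: "('k::field, 'a::ab_group_add) restricted_lie" +
  assumes sq_scal: "sq L (scal L c x) = scal L (c\<^sup>2) (sq L x)"
    and brk_sq: "brk L x (sq L y) = brk L (brk L x y) y"
    and sq_add: "sq L (x + y) = sq L x + sq L y + brk L x y"

locale restricted_morphism =
  source: restricted_lie_algebra L + target: restricted_lie_algebra M
  for L :: "('k::field, 'a::ab_group_add) restricted_lie"
    and M :: "('k, 'b::ab_group_add) restricted_lie"
    and \<phi> :: "'a \<Rightarrow> 'b" +
  assumes morphism_linear: "Vector_Spaces.linear (scal L) (scal M) \<phi>"
    and morphism_brk: "\<phi> (brk L x y) = brk M (\<phi> x) (\<phi> y)"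
    and morphism_sq: "\<phi> (sq L x) = sq M (\<phi> x)"

locale restricted_module = restricted_lie_algebra L + V: vector_space s
  for L :: "('k::field, 'a::ab_group_add) restricted_lie"
    and s :: "'k \<Rightarrow> 'v::ab_group_add \<Rightarrow> 'v"
    and act :: "'a \<Rightarrow> 'v \<Rightarrow> 'v" +
  assumes act_linear_left: "Vector_Spaces.linear (scal L) s (\<lambda>x. act x m)"
    and act_linear_right: "Vector_Spaces.linear s s (act x)"
    and act_brk: "act (brk L x y) m = act x (act y m) - act y (act x m)"
    and act_sq: "act (sq L x) m = act x (act x m)"

definition pullback_action ::
  "('k, 'b) restricted_lie \<Rightarrow> ('a \<Rightarrow> 'b) \<Rightarrow> 'a \<Rightarrow> 'b \<Rightarrow> 'b" where
  "pullback_action M \<phi> x m = brk M (\<phi> x) m"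


section \<open>Restricted cohomology\<close>

text \<open>
  A map with \<open>n\<close> arguments is a function on lists that is zero on lists of length other than \<open>n\<close>.
  This makes the representation unique, so that equality of maps is equality of functions.
  Alternating means vanishing on repeated arguments.
\<close>

definition alt_maps ::
  "('k::field \<Rightarrow> 'a::ab_group_add \<Rightarrow> 'a) \<Rightarrow> ('k \<Rightarrow> 'v::ab_group_add \<Rightarrow> 'v) \<Rightarrow> nat
    \<Rightarrow> ('a list \<Rightarrow> 'v) set" where
  "alt_maps sL sV n =
    {\<psi>. (\<forall>xs i. length xs = n \<longrightarrow> i < n \<longrightarrow> Vector_Spaces.linear sL sV (\<lambda>y. \<psi> (xs[i := y])))
       \<and> (\<forall>xs i j. length xs = n \<longrightarrow> i < j \<longrightarrow> j < n \<longrightarrow> xs ! i = xs ! j \<longrightarrow> \<psi> xs = 0)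
       \<and> (\<forall>xs. length xs \<noteq> n \<longrightarrow> \<psi> xs = 0)}"

text \<open>
  \<open>nths xs (- {i, j})\<close> is \<open>xs\<close> with the entries at positions \<open>i\<close> and \<open>j\<close> omitted;
  positions count from 0.
\<close>

definition d_CE ::
  "('k, 'a) restricted_lie \<Rightarrow> ('a \<Rightarrow> 'v \<Rightarrow> 'v) \<Rightarrow> nat
    \<Rightarrow> ('a list \<Rightarrow> 'v) \<Rightarrow> 'a list \<Rightarrow> 'v::ab_group_add" where
  "d_CE L act n \<psi> xs =
    (if length xs = Suc n then
       (\<Sum>j<Suc n. \<Sum>i<j. \<psi> (brk L (xs ! i) (xs ! j) # nths xs (- {i, j})))
       + (\<Sum>i<Suc n. act (xs ! i) (\<psi> (nths xs (- {i}))))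
     else 0)"

type_synonym ('a, 'v) cochain = "('a list \<Rightarrow> 'v) \<times> ('a \<Rightarrow> 'a list \<Rightarrow> 'v)"

text \<open>
  \<open>\<omega> x zs\<close> stands for \<open>\<omega>(x, z\<^sub>2, \<dots>, z\<^sub>n\<^sub>-\<^sub>1)\<close> with \<open>zs = [z\<^sub>2, \<dots>, z\<^sub>n\<^sub>-\<^sub>1]\<close>.
  To have one type for all degrees, an element \<open>\<psi>\<close> of \<open>C\<^sup>0 = V\<close> or \<open>C\<^sup>1 = Hom(L, V)\<close> is
  represented by \<open>(\<psi>, 0)\<close>; an element \<open>v\<close> of \<open>V\<close> is the map with no arguments and value \<open>v\<close>.
\<close>

definition cochains ::
  "('k::field, 'a::ab_group_add) restricted_lie \<Rightarrow> ('k \<Rightarrow> 'v::ab_group_add \<Rightarrow> 'v) \<Rightarrow> nat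
    \<Rightarrow> ('a, 'v) cochain set" where
  "cochains L s n =
    (if n \<le> 1 then {(\<psi>, \<omega>). \<psi> \<in> alt_maps (scal L) s n \<and> \<omega> = 0}
     else {(\<psi>, \<omega>). \<psi> \<in> alt_maps (scal L) s n
       \<and> (\<forall>x. \<omega> x \<in> alt_maps (scal L) s (n - 2))
       \<and> (\<forall>c x zs. length zs = n - 2 \<longrightarrow> \<omega> (scal L c x) zs = s (c\<^sup>2) (\<omega> x zs))
       \<and> (\<forall>x y zs. length zs = n - 2 \<longrightarrow>
            \<omega> (x + y) zs = \<omega> x zs + \<omega> y zs + \<psi> (x # y # zs))})"

text \<open>
  \<open>delta L act n (\<psi>, \<omega>)\<close> is \<open>\<delta>\<^sup>1\<psi>\<close> for \<open>n = 1\<close> and \<open>\<delta>\<^sup>n\<omega>\<close> for \<open>n \<ge> 2\<close>, where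
  \<open>zs = [z\<^sub>2, \<dots>, z\<^sub>n]\<close>. The value for \<open>n = 0\<close> is a convention, as
  there is no \<open>\<delta>\<^sup>0\<close>.
\<close>

definition delta ::
  "('k, 'a) restricted_lie \<Rightarrow> ('a \<Rightarrow> 'v \<Rightarrow> 'v) \<Rightarrow> nat
    \<Rightarrow> ('a, 'v) cochain \<Rightarrow> 'a \<Rightarrow> 'a list \<Rightarrow> 'v::ab_group_add" where
  "delta L act n = (\<lambda>(\<psi>, \<omega>) x zs.
    (if n = 0 then 0
     else if length zs \<noteq> n - 1 then 0
     else if n = 1 then \<psi> [sq L x] + act x (\<psi> [x])
     else act x (\<psi> (x # zs))
       + (\<Sum>i<n - 1. act (zs ! i) (\<omega> x (nths zs (- {i}))))
       + \<psi> (sq L x # zs)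
       + (\<Sum>i<n - 1. \<psi> (brk L x (zs ! i) # x # nths zs (- {i})))
       + (\<Sum>j<n - 1. \<Sum>i<j. \<omega> x (brk L (zs ! i) (zs ! j) # nths zs (- {i, j})))))"


section \<open>The deformation complex of a restricted morphism\<close>

type_synonym ('a, 'b) def_cochain = "('a, 'a) cochain \<times> ('b, 'b) cochain \<times> ('a, 'b) cochain"

definition def_cochains ::
  "('k::field, 'a::ab_group_add) restricted_lie \<Rightarrow> ('k, 'b::ab_group_add) restricted_lie \<Rightarrow> nat
    \<Rightarrow> ('a, 'b) def_cochain set" where
  "def_cochains L M n =
    (if n = 0 then {0}
     else cochains L (scal L) n \<times> cochains M (scal M) n \<times> cochains L (scal M) (n - 1))"

definition def_alpha ::
  "('k, 'a) restricted_lie \<Rightarrow> ('k, 'b) restricted_lie \<Rightarrow> ('a \<Rightarrow> 'b) \<Rightarrow> nat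
    \<Rightarrow> ('a list \<Rightarrow> 'a) \<Rightarrow> ('b list \<Rightarrow> 'b) \<Rightarrow> ('a list \<Rightarrow> 'b) \<Rightarrow> 'a list \<Rightarrow> 'b::ab_group_add" where
  "def_alpha L M \<phi> n \<mu> \<nu> \<theta> xs =
    \<phi> (\<mu> xs) + \<nu> (map \<phi> xs) + d_CE L (pullback_action M \<phi>) (n - 1) \<theta> xs"

text \<open>For \<open>n = 2\<close> the last summand is \<open>\<delta>\<^sup>1\<theta>\<close>, which does not involve \<open>\<rho>\<close>.\<close>

definition def_beta ::
  "('k, 'a) restricted_lie \<Rightarrow> ('k, 'b) restricted_lie \<Rightarrow> ('a \<Rightarrow> 'b) \<Rightarrow> nat
    \<Rightarrow> ('a \<Rightarrow> 'a list \<Rightarrow> 'a) \<Rightarrow> ('b \<Rightarrow> 'b list \<Rightarrow> 'b) \<Rightarrow> ('a, 'b) cochain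
    \<Rightarrow> 'a \<Rightarrow> 'a list \<Rightarrow> 'b::ab_group_add" where
  "def_beta L M \<phi> n \<omega> \<epsilon> \<theta>\<rho> x zs =
    \<phi> (\<omega> x zs) + \<epsilon> (\<phi> x) (map \<phi> zs) + delta L (pullback_action M \<phi>) (n - 1) \<theta>\<rho> x zs"

text \<open>
  For \<open>n = 1\<close> the third component of the value lies in \<open>C\<^sup>1(L, M)\<close>, hence the second entry 0 there.
\<close>

definition def_diff ::
  "('k, 'a) restricted_lie \<Rightarrow> ('k, 'b) restricted_lie \<Rightarrow> ('a \<Rightarrow> 'b) \<Rightarrow> nat
    \<Rightarrow> ('a::ab_group_add, 'b::ab_group_add) def_cochain \<Rightarrow> ('a, 'b) def_cochain" where
  "def_diff L M \<phi> n = (\<lambda>((\<mu>, \<omega>), (\<nu>, \<epsilon>), (\<theta>, \<rho>)).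
    (if n = 0 then 0
     else ((d_CE L (brk L) n \<mu>, delta L (brk L) n (\<mu>, \<omega>)),
           (d_CE M (brk M) n \<nu>, delta M (brk M) n (\<nu>, \<epsilon>)),
           (def_alpha L M \<phi> n \<mu> \<nu> \<theta>,
            if n = 1 then 0 else def_beta L M \<phi> n \<omega> \<epsilon> (\<theta>, \<rho>)))))"


section \<open>The coefficient modules\<close>

lemma char_2_minus_eq:
  fixes s :: "'k::field \<Rightarrow> 'v::ab_group_add \<Rightarrow> 'v"
  assumes "CHAR('k) = 2" "vector_space s"
  shows "- v = (v :: 'v)"
proof -
  interpret vector_space s by fact
  have "(1 :: 'k) + 1 = of_nat CHAR('k)" by (simp add: assms(1))
  then have "(1 :: 'k) + 1 = 0" by (simp only: of_nat_CHAR)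
  then have "s 1 v + s 1 v = 0" by (metis scale_left_distrib scale_zero_left)
  then show ?thesis by (simp add: minus_unique)
qed

lemma restricted_module_pullback:
  fixes L :: "('k::field, 'a::ab_group_add) restricted_lie"
    and M :: "('k, 'b::ab_group_add) restricted_lie"
  assumes char: "CHAR('k) = 2" and mor: "restricted_morphism L M \<phi>"
  shows "restricted_module L (scal M) (pullback_action M \<phi>)"
proof -
  interpret restricted_morphism L M \<phi> by fact
  interpret lr: Vector_Spaces.linear "scal M" "scal M" "\<lambda>y. brk M x y" for x
    by (rule target.brk_linear_right)
  interpret ll: Vector_Spaces.linear "scal M" "scal M" "\<lambda>x. brk M x y" for y
    by (rule target.brk_linear_left)
  have neg: "- v = v" for v :: 'b
    using char_2_minus_eq[OF char] target.vector_space_axioms by blast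
  have anti: "brk M x y = brk M y x" for x y
  proof -
    have "brk M (x + y) (x + y) = brk M x x + brk M y x + (brk M x y + brk M y y)"
      by (simp only: lr.add ll.add)
    then have "brk M x y + brk M y x = 0"
      by (simp add: target.brk_self add.commute)
    then show ?thesis by (metis neg add_eq_0_iff)
  qed
  show ?thesis
  proof (rule restricted_module.intro[OF source.restricted_lie_algebra_axioms
        target.vector_space_axioms restricted_module_axioms.intro])
    fix m
    show "Vector_Spaces.linear (scal L) (scal M) (\<lambda>x. pullback_action M \<phi> x m)"
      using Vector_Spaces.linear_compose[OF morphism_linear target.brk_linear_left]
      by (simp add: pullback_action_def o_def)
  next
    fix x
    show "Vector_Spaces.linear (scal M) (scal M) (pullback_action M \<phi> x)"
      using target.brk_linear_right by (simp add: pullback_action_def[abs_def])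
  next
    fix x y m
    have "brk M (\<phi> x) (brk M (\<phi> y) m) + brk M (\<phi> y) (brk M m (\<phi> x))
        + brk M m (brk M (\<phi> x) (\<phi> y)) = 0"
      by (rule target.jacobi)
    then show "pullback_action M \<phi> (brk L x y) m
      = pullback_action M \<phi> x (pullback_action M \<phi> y m)
        - pullback_action M \<phi> y (pullback_action M \<phi> x m)"
      unfolding pullback_action_def morphism_brk
      by (metis anti neg add_eq_0_iff diff_conv_add_uminus)
  next
    fix x m
    show "pullback_action M \<phi> (sq L x) m = pullback_action M \<phi> x (pullback_action M \<phi> x m)"
      unfolding pullback_action_def morphism_sq by (metis anti target.brk_sq)
  qed
qed

lemma restricted_module_adjoint:
  fixes L :: "('k::field, 'a::ab_group_add) restricted_lie"
  assumes "CHAR('k) = 2" "restricted_lie_algebra L"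
  shows "restricted_module L (scal L) (brk L)"
proof -
  interpret restricted_lie_algebra L by fact
  have "restricted_morphism L L (\<lambda>x. x)"
    by unfold_locales (simp_all add: algebra_simps)
  from restricted_module_pullback[OF assms(1) this] show ?thesis
    by (simp add: pullback_action_def[abs_def])
qed

end

theory Submission
  imports Defs
begin

text \<open>
  In characteristic 2 write \<open>\<iota>\<^sub>x\<close> for the insertion of \<open>x\<close> as first argument and
  \<open>\<theta>\<^sub>x\<close> for the Lie derivative. Cartan's formula \<open>\<iota>\<^sub>x d = \<theta>\<^sub>x + d \<iota>\<^sub>x\<close> determines \<open>d\<close> recursively, so
  \<open>d \<theta>\<^sub>x = \<theta>\<^sub>x d\<close>, \<open>d d = 0\<close> and \<open>\<theta>\<^sub>x \<theta>\<^sub>x = \<theta>\<close> at \<open>x\<^sup>[\<^sup>2\<^sup>]\<close> follow by induction on the number of arguments.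
  In these terms \<open>\<delta>\<omega>(x) = \<psi>(x\<^sup>[\<^sup>2\<^sup>], \<dots>) + \<theta>\<^sub>x \<iota>\<^sub>x \<psi> + d(\<omega>(x))\<close>, and \<open>\<delta>\<delta> = 0\<close> is a three-line
  computation. The deformation complex is the mapping cone of
  \<open>(\<mu>, \<nu>) \<mapsto> \<phi> \<circ> \<mu> + \<nu> \<circ> \<phi>\<close>, which commutes with \<open>d\<close> and \<open>\<delta>\<close> because \<open>\<phi>\<close> is a restricted morphism.
\<close>

section \<open>Alternating maps without a fixed number of arguments\<close>

text \<open>
  Unlike \<^const>\<open>alt_maps\<close> this does not mention the number of arguments, which
  makes it stable under insertion of an argument.
\<close>

definition alternating ::
  "('k::field \<Rightarrow> 'a::ab_group_add \<Rightarrow> 'a) \<Rightarrow> ('k \<Rightarrow> 'v::ab_group_add \<Rightarrow> 'v)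
    \<Rightarrow> ('a list \<Rightarrow> 'v) \<Rightarrow> bool" where
  "alternating sL sV \<psi> \<longleftrightarrow>
    (\<forall>us vs. Vector_Spaces.linear sL sV (\<lambda>y. \<psi> (us @ y # vs)))
    \<and> (\<forall>us z vs. \<psi> (us @ z # z # vs) = 0)"

lemma alternating_contract:
  assumes "alternating sL sV \<psi>"
  shows "alternating sL sV (\<lambda>ys. \<psi> (z # ys))"
  unfolding alternating_def
proof (intro conjI allI)
  fix us vs
  have "Vector_Spaces.linear sL sV (\<lambda>y. \<psi> ((z # us) @ y # vs))"
    using assms unfolding alternating_def by blast
  then show "Vector_Spaces.linear sL sV (\<lambda>y. \<psi> (z # us @ y # vs))" by simp
next
  fix us y vs
  have "\<psi> ((z # us) @ y # y # vs) = 0" using assms unfolding alternating_def by blast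
  then show "\<psi> (z # us @ y # y # vs) = 0" by simp
qed

lemma alternating_linear:
  "alternating sL sV \<psi> \<Longrightarrow> Vector_Spaces.linear sL sV (\<lambda>y. \<psi> (us @ y # vs))"
  by (simp add: alternating_def)

lemma alternating_add:
  "alternating sL sV \<psi> \<Longrightarrow> \<psi> (us @ (x + y) # vs) = \<psi> (us @ x # vs) + \<psi> (us @ y # vs)"
  by (drule alternating_linear[of _ _ _ us vs]) (simp add: Vector_Spaces.linear_iff)

lemma alternating_swap:
  assumes "alternating sL sV \<psi>"
  shows "\<psi> (us @ x # y # vs) = - \<psi> (us @ y # x # vs)"
proof -
  note A = alternating_add[OF assms]
  have 0: "\<psi> (us @ z # z # vs) = 0" for z
    using assms by (simp add: alternating_def)
  have "0 = \<psi> (us @ (x + y) # (x + y) # vs)" by (simp add: 0)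
  also have "\<dots> = \<psi> (us @ x # (x + y) # vs) + \<psi> (us @ y # (x + y) # vs)" by (rule A)
  also have "\<dots> = \<psi> (us @ x # y # vs) + \<psi> (us @ y # x # vs)"
    using A[of "us @ [x]" x y vs] A[of "us @ [y]" x y vs] by (simp add: 0)
  finally show ?thesis by (simp add: eq_neg_iff_add_eq_0)
qed

text \<open>Transpositions carry the first \<open>z\<close> past \<open>vs\<close> until the two
  copies of \<open>z\<close> are adjacent; each of them only changes the sign.\<close>

lemma alternating_repeat:
  assumes "alternating sL sV \<psi>"
  shows "\<psi> (us @ z # vs @ z # ws) = 0"
proof (induction vs arbitrary: us)
  case Nil
  show ?case using assms by (simp add: alternating_def)
next
  case (Cons v vs)
  have "\<psi> (us @ z # v # vs @ z # ws) = - \<psi> ((us @ [v]) @ z # vs @ z # ws)"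
    using alternating_swap[OF assms, of us z v "vs @ z # ws"] by simp
  then show ?case by (simp only: Cons append_Cons minus_zero)
qed

text \<open>Forwards, lengths other than \<open>n\<close> give the zero map, which is linear.
  Backwards, \<open>alternating_repeat\<close> extends vanishing from adjacent to arbitrary equal
  entries.\<close>

lemma alt_maps_iff:
  assumes "vector_space sL" "vector_space sV"
  shows "\<psi> \<in> alt_maps sL sV n \<longleftrightarrow> alternating sL sV \<psi> \<and> (\<forall>xs. length xs \<noteq> n \<longrightarrow> \<psi> xs = 0)"
    (is "?l \<longleftrightarrow> ?r")
proof
  assume l: ?l
  then have supp: "length xs \<noteq> n \<Longrightarrow> \<psi> xs = 0" for xs by (simp add: alt_maps_def)
  have "Vector_Spaces.linear sL sV (\<lambda>y. \<psi> (us @ y # vs))" for us vs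
  proof (cases "length us + Suc (length vs) = n")
    case True
    then have "length (us @ 0 # vs) = n" "length us < n" by simp_all
    moreover have "\<forall>xs i. length xs = n \<longrightarrow> i < n
        \<longrightarrow> Vector_Spaces.linear sL sV (\<lambda>y. \<psi> (xs[i := y]))"
      using l by (simp add: alt_maps_def)
    ultimately have "Vector_Spaces.linear sL sV (\<lambda>y. \<psi> ((us @ 0 # vs)[length us := y]))"
      by blast
    then show ?thesis by simp
  next
    case False
    have eq: "(\<lambda>y. \<psi> (us @ y # vs)) = (\<lambda>y. 0)"
      by (rule ext, rule supp) (use False in simp)
    interpret vector_space_pair sL sV using assms by (rule vector_space_pair.intro)
    show ?thesis unfolding eq by (rule linear_zero)
  qed
  moreover have "\<psi> (us @ z # z # vs) = 0" for us z vs
  proof (cases "length us + Suc (Suc (length vs)) = n")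
    case True
    let ?xs = "us @ z # z # vs"
    have "\<forall>i j. length ?xs = n \<longrightarrow> i < j \<longrightarrow> j < n \<longrightarrow> ?xs ! i = ?xs ! j \<longrightarrow> \<psi> ?xs = 0"
      using l by (simp add: alt_maps_def)
    from this[rule_format, of "length us" "Suc (length us)"] show ?thesis
      using True by (simp add: nth_append)
  qed (simp add: supp)
  ultimately show ?r using supp by (simp add: alternating_def)
next
  assume r: ?r
  have "Vector_Spaces.linear sL sV (\<lambda>y. \<psi> (xs[i := y]))" if "length xs = n" "i < n" for xs i
    using that alternating_linear[of sL sV \<psi> "take i xs" "drop (Suc i) xs"] conjunct1[OF r]
    by (simp add: upd_conv_take_nth_drop)
  moreover have "\<psi> xs = 0" if "length xs = n" "i < j" "j < n" "xs ! i = xs ! j" for xs i j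
  proof -
    let ?t = "drop (Suc i) xs"
    have "?t = take (j - Suc i) ?t @ ?t ! (j - Suc i) # drop (Suc (j - Suc i)) ?t"
      using that by (intro id_take_nth_drop) simp
    moreover have "?t ! (j - Suc i) = xs ! i" using that by simp
    moreover have "xs = take i xs @ xs ! i # ?t" using that by (intro id_take_nth_drop) simp
    ultimately have "xs = take i xs @ xs ! i # take (j - Suc i) ?t @ xs ! i # drop (Suc (j - Suc i)) ?t"
      by metis
    then show ?thesis using alternating_repeat[OF conjunct1[OF r]] by metis
  qed
  ultimately show ?l using r by (simp add: alt_maps_def)
qed

section \<open>Lie derivative and Cartan differential\<close>

text \<open>The second equation is the rule that moving a Lie derivative past the insertion of
  \<open>x\<close> produces the insertion of \<open>brk L z x\<close>, with the sign dropped as in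
  characteristic 2.\<close>

primrec lie_der ::
  "('k, 'a) restricted_lie \<Rightarrow> ('a \<Rightarrow> 'v \<Rightarrow> 'v) \<Rightarrow> 'a \<Rightarrow> ('a list \<Rightarrow> 'v) \<Rightarrow> 'a list \<Rightarrow> 'v::ab_group_add"
  where
  "lie_der L act z \<psi> [] = act z (\<psi> [])"
| "lie_der L act z \<psi> (x # xs) =
    lie_der L act z (\<lambda>ys. \<psi> (x # ys)) xs + \<psi> (brk L z x # xs)"

text \<open>Cartan's formula \<open>\<iota>\<^sub>x d = \<theta>\<^sub>x + d \<iota>\<^sub>x\<close>, read as a recursion.\<close>

primrec cartan_d ::
  "('k, 'a) restricted_lie \<Rightarrow> ('a \<Rightarrow> 'v \<Rightarrow> 'v) \<Rightarrow> ('a list \<Rightarrow> 'v) \<Rightarrow> 'a list \<Rightarrow> 'v::ab_group_add"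
  where
  "cartan_d L act \<psi> [] = 0"
| "cartan_d L act \<psi> (x # xs) = lie_der L act x \<psi> xs + cartan_d L act (\<lambda>ys. \<psi> (x # ys)) xs"

section \<open>Cartan calculus on a restricted module in characteristic 2\<close>

locale restricted_module_char_2 = restricted_module L s act
  for L :: "('k::field, 'a::ab_group_add) restricted_lie"
    and s :: "'k \<Rightarrow> 'v::ab_group_add \<Rightarrow> 'v"
    and act :: "'a \<Rightarrow> 'v \<Rightarrow> 'v" +
  assumes char_2: "CHAR('k) = 2"
begin

abbreviation "alt \<equiv> alternating (scal L) s"
abbreviation "\<theta> \<equiv> lie_der L act"
abbreviation "D \<equiv> cartan_d L act"

lemma add_self: "v + v = 0" for v :: 'v
  using char_2_minus_eq[OF char_2 V.vector_space_axioms, of v] by (metis add.right_inverse)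

lemma add_self_left: "v + (v + w) = w" for v w :: 'v
  by (simp add: add_self flip: add.assoc)

lemma add_self': "x + x = 0" for x :: 'a
  using char_2_minus_eq[OF char_2 vector_space_axioms, of x] by (metis add.right_inverse)

lemmas cancel_2 = add_self add_self_left

lemma act_add: "act x (v + w) = act x v + act x w" and act_scale: "act x (s c v) = s c (act x v)"
  using act_linear_right[of x] by (simp_all add: Vector_Spaces.linear_iff)

lemma act_add_left: "act (x + y) v = act x v + act y v"
    and act_scale_left: "act (scal L c x) v = s c (act x v)"
  using act_linear_left[of v] by (simp_all add: Vector_Spaces.linear_iff)

lemma act_zero: "act x 0 = 0"
  using act_add[of x 0 0] by simp

lemma brk_add: "brk L x (y + z) = brk L x y + brk L x z"
  using brk_linear_right[of x] by (simp add: Vector_Spaces.linear_iff)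

lemma brk_add_left: "brk L (x + y) z = brk L x z + brk L y z"
    and brk_scale_left: "brk L (scal L c x) z = scal L c (brk L x z)"
  using brk_linear_left[of z] by (simp_all add: Vector_Spaces.linear_iff)

lemma brk_commute: "brk L x y = brk L y x"
proof -
  have "brk L (x + y) (x + y) = 0" by (rule brk_self)
  then have "brk L x y + brk L y x = 0"
    unfolding brk_add brk_add_left by (simp add: brk_self add.commute)
  then show ?thesis by (metis add_self' add_right_imp_eq)
qed

lemma brk_brk: "brk L x (brk L y z) + brk L y (brk L x z) = brk L (brk L x y) z"
  using jacobi[of x y z] add_self'[of "brk L (brk L x y) z"]
  unfolding brk_commute[of z x] brk_commute[of z "brk L x y"]
  by (metis add_right_imp_eq)

lemma act_act: "act x (act y v) + act y (act x v) = act (brk L x y) v"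
  unfolding act_brk diff_conv_add_uminus
  by (simp add: char_2_minus_eq[OF char_2 V.vector_space_axioms])

lemma brk_brk_self: "brk L x (brk L x y) = brk L (sq L x) y"
  by (metis brk_sq brk_commute)

lemma alt_head:
  assumes "alt \<psi>"
  shows "Vector_Spaces.linear (scal L) s (\<lambda>y. \<psi> (y # ys))"
    and "\<psi> ((x + y) # ys) = \<psi> (x # ys) + \<psi> (y # ys)"
    and "\<psi> (scal L c x # ys) = s c (\<psi> (x # ys))"
    and "\<psi> (0 # ys) = 0"
    and "\<psi> (x # x # ys) = 0"
proof -
  show l: "Vector_Spaces.linear (scal L) s (\<lambda>y. \<psi> (y # ys))"
    using alternating_linear[OF assms, of "[]"] by simp
  from l show a: "\<psi> ((x + y) # ys) = \<psi> (x # ys) + \<psi> (y # ys)" for x y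
    by (simp add: Vector_Spaces.linear_iff)
  from l show "\<psi> (scal L c x # ys) = s c (\<psi> (x # ys))" by (simp add: Vector_Spaces.linear_iff)
  show "\<psi> (0 # ys) = 0" using a[of 0 0] by simp
  show "\<psi> (x # x # ys) = 0" using alternating_repeat[OF assms, of "[]" x "[]"] by simp
qed

lemma alt_swap: "alt \<psi> \<Longrightarrow> \<psi> (x # y # ys) = \<psi> (y # x # ys)"
  using alternating_swap[of "scal L" s \<psi> "[]" x y ys]
    char_2_minus_eq[OF char_2 V.vector_space_axioms, of "\<psi> (y # x # ys)"]
  unfolding append_Nil by (rule trans)

lemma theta_add: "\<theta> z (\<lambda>ys. f ys + g ys) xs = \<theta> z f xs + \<theta> z g xs"
  by (induction xs arbitrary: f g) (simp_all add: act_add ac_simps)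

lemma theta_scale: "\<theta> z (\<lambda>ys. s c (f ys)) xs = s c (\<theta> z f xs)"
  by (induction xs arbitrary: f) (simp_all add: act_scale V.scale_right_distrib)

lemma theta_zero: "\<theta> z (\<lambda>ys. 0) = (\<lambda>xs. 0)"
proof
  show "\<theta> z (\<lambda>ys. 0) xs = 0" for xs by (induction xs) (simp_all add: act_zero)
qed

lemma D_add: "D (\<lambda>ys. f ys + g ys) xs = D f xs + D g xs"
  by (induction xs arbitrary: f g) (simp_all add: theta_add ac_simps)

lemma D_scale: "D (\<lambda>ys. s c (f ys)) xs = s c (D f xs)"
  by (induction xs arbitrary: f) (simp_all add: theta_scale V.scale_right_distrib)

lemma D_zero: "D (\<lambda>ys. 0) = (\<lambda>xs. 0)"
proof
  show "D (\<lambda>ys. 0) xs = 0" for xs by (induction xs) (simp_all add: theta_zero)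
qed

lemma theta_add_left: "alt \<psi> \<Longrightarrow> \<theta> (x + y) \<psi> xs = \<theta> x \<psi> xs + \<theta> y \<psi> xs"
  by (induction xs arbitrary: \<psi>)
    (simp_all add: act_add_left brk_add_left alt_head alternating_contract ac_simps)

lemma theta_scale_left: "alt \<psi> \<Longrightarrow> \<theta> (scal L c x) \<psi> xs = s c (\<theta> x \<psi> xs)"
  by (induction xs arbitrary: \<psi>)
    (simp_all add: act_scale_left brk_scale_left alt_head alternating_contract V.scale_right_distrib)

text \<open>After insertion of \<open>w\<close>, the mixed terms, with one bracket by
  \<open>w\<close> and one remaining Lie derivative, occur twice and cancel, while the doubly
  bracketed terms combine by the Jacobi identity \<open>brk_brk\<close>.\<close>

lemma theta_commutator:
  "alt \<psi> \<Longrightarrow> \<theta> x (\<theta> y \<psi>) xs + \<theta> y (\<theta> x \<psi>) xs = \<theta> (brk L x y) \<psi> xs"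
proof (induction xs arbitrary: \<psi>)
  case Nil
  then show ?case by (simp add: act_act)
next
  case (Cons w xs)
  have "\<psi> (brk L (brk L x y) w # xs) = \<psi> (brk L x (brk L y w) # xs) + \<psi> (brk L y (brk L x w) # xs)"
    using alt_head(2)[OF Cons.prems] by (simp flip: brk_brk)
  moreover note Cons.IH[OF alternating_contract[OF Cons.prems, of w], symmetric]
  ultimately show ?case by (simp add: theta_add cancel_2 ac_simps)
qed

text \<open>With both derivatives along \<open>x\<close> the mixed term occurs twice, and double
  bracketing is bracketing with \<open>sq L x\<close>. The base case is
  \<open>act_sq\<close>.\<close>

lemma theta_theta: "alt \<psi> \<Longrightarrow> \<theta> x (\<theta> x \<psi>) xs = \<theta> (sq L x) \<psi> xs"
proof (induction xs arbitrary: \<psi>)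
  case Nil
  then show ?case by (simp add: act_sq)
next
  case (Cons w xs)
  then show ?case
    by (simp add: theta_add alternating_contract cancel_2 brk_brk_self ac_simps)
qed

text \<open>After insertion of \<open>w\<close>, Cartan's formula leaves
  \<open>\<theta> w (\<theta> z \<psi>)\<close> on one side and
  \<open>\<theta> z (\<theta> w \<psi>)\<close> on the other; the term
  \<open>\<theta> (brk L z w) \<psi>\<close> accounts for the difference.\<close>

lemma D_theta: "alt \<psi> \<Longrightarrow> D (\<theta> z \<psi>) xs = \<theta> z (D \<psi>) xs"
proof (induction xs arbitrary: \<psi>)
  case Nil
  then show ?case by (simp add: act_zero)
next
  case (Cons w xs)
  have "\<theta> z (\<theta> w \<psi>) xs + \<theta> (brk L z w) \<psi> xs = \<theta> w (\<theta> z \<psi>) xs"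
    by (simp add: cancel_2 flip: theta_commutator[OF Cons.prems])
  with Cons show ?case
    by (simp add: theta_add D_add alternating_contract ac_simps)
qed

text \<open>Insertion of \<open>w\<close> gives
  \<open>\<theta> w (D \<psi>) + D (\<theta> w \<psi>)\<close> plus a term with one argument less;
  the two summands agree by \<open>D_theta\<close>.\<close>

lemma D_D: "alt \<psi> \<Longrightarrow> D (D \<psi>) xs = 0"
  by (induction xs arbitrary: \<psi>)
    (simp_all add: D_add D_theta alternating_contract cancel_2)

section \<open>Preservation of alternation and of the number of arguments\<close>

lemma linear_theta:
  assumes "\<And>ys. Vector_Spaces.linear (scal L) s (\<lambda>y. F y ys)"
  shows "Vector_Spaces.linear (scal L) s (\<lambda>y. \<theta> z (F y) ys)"
proof -
  \<comment> \<open>\<open>F y\<close> stands for the insertion of \<open>y\<close>; its linearity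
    in \<open>y\<close> is restated as equations of functions, to which \<open>theta_add\<close> and
    \<open>theta_scale\<close> apply.\<close>
  have "F (x + y) = (\<lambda>ys. F x ys + F y ys)" "F (scal L c x) = (\<lambda>ys. s c (F x ys))" for x y c
    using assms by (auto simp: Vector_Spaces.linear_iff)
  then show ?thesis using vector_space_axioms V.vector_space_axioms
    by (simp add: Vector_Spaces.linear_iff theta_add theta_scale)
qed

lemma linear_D:
  assumes "\<And>ys. Vector_Spaces.linear (scal L) s (\<lambda>y. F y ys)"
  shows "Vector_Spaces.linear (scal L) s (\<lambda>y. D (F y) ys)"
proof -
  have "F (x + y) = (\<lambda>ys. F x ys + F y ys)" "F (scal L c x) = (\<lambda>ys. s c (F x ys))" for x y c
    using assms by (auto simp: Vector_Spaces.linear_iff)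
  then show ?thesis using vector_space_axioms V.vector_space_axioms
    by (simp add: Vector_Spaces.linear_iff D_add D_scale)
qed

lemma linear_plus:
  assumes "Vector_Spaces.linear (scal L) s f" "Vector_Spaces.linear (scal L) s g"
  shows "Vector_Spaces.linear (scal L) s (\<lambda>y. f y + g y)"
  using assms by (simp add: Vector_Spaces.linear_iff V.scale_right_distrib ac_simps)

lemma alt_theta:
  assumes "alt \<psi>"
  shows "alt (\<theta> z \<psi>)"
  unfolding alternating_def
proof (intro conjI allI)
  fix us vs
  show "Vector_Spaces.linear (scal L) s (\<lambda>y. \<theta> z \<psi> (us @ y # vs))"
    using assms
  proof (induction us arbitrary: \<psi>)
    case Nil
    have "Vector_Spaces.linear (scal L) s (\<lambda>y. \<psi> (brk L z y # vs))"
      using Vector_Spaces.linear_compose[OF brk_linear_right[of z] alt_head(1)[OF Nil, of vs]] by (simp add: o_def)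
    with Nil show ?case by (auto intro!: linear_plus linear_theta alt_head)
  next
    case (Cons u us)
    then show ?case
      using alternating_linear[OF Cons.prems, of "_ # us"]
      by (auto intro!: linear_plus Cons.IH alternating_contract)
  qed
next
  fix us y vs
  show "\<theta> z \<psi> (us @ y # y # vs) = 0"
    using assms
  proof (induction us arbitrary: \<psi>)
    case Nil
    \<comment> \<open>The two terms in which one of the equal arguments is bracketed agree after a
      swap.\<close>
    then show ?case using alt_swap[OF Nil, of y "brk L z y" vs] by (simp add: alt_head theta_zero cancel_2)
  next
    case (Cons u us)
    then show ?case using alternating_contract[OF Cons.prems]
      by (simp add: Cons.IH alternating_def)
  qed
qed

lemma alt_D:
  assumes "alt \<psi>"
  shows "alt (D \<psi>)"
  unfolding alternating_def
proof (intro conjI allI)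
  fix us vs
  show "Vector_Spaces.linear (scal L) s (\<lambda>y. D \<psi> (us @ y # vs))"
    using assms
  proof (induction us arbitrary: \<psi>)
    case Nil
    have "Vector_Spaces.linear (scal L) s (\<lambda>y. \<theta> y \<psi> vs)"
      using vector_space_axioms V.vector_space_axioms Nil
      by (simp add: Vector_Spaces.linear_iff theta_add_left theta_scale_left)
    with Nil show ?case by (auto intro!: linear_plus linear_D alt_head)
  next
    case (Cons u us)
    show ?case
      using linear_plus[OF alternating_linear[OF alt_theta[OF Cons.prems, of u]]
          Cons.IH[OF alternating_contract[OF Cons.prems]]]
      by simp
  qed
next
  fix us y vs
  show "D \<psi> (us @ y # y # vs) = 0"
    using assms
  proof (induction us arbitrary: \<psi>)
    case Nil
    \<comment> \<open>Two expansions of \<open>D\<close> produce the Lie derivative along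
      \<open>y\<close> of the insertion of \<open>y\<close> twice; the other terms contain
      \<open>brk L y y\<close> or insert \<open>y\<close> twice.\<close>
    then show ?case by (simp add: alt_head theta_zero D_zero cancel_2 brk_self)
  next
    case (Cons u us)
    then show ?case using alt_theta[OF Cons.prems, of u] alternating_contract[OF Cons.prems]
      by (simp add: Cons.IH alternating_def)
  qed
qed

lemma theta_support:
  "\<lbrakk>\<And>xs. length xs \<noteq> n \<Longrightarrow> \<psi> xs = 0; length xs \<noteq> n\<rbrakk> \<Longrightarrow> \<theta> z \<psi> xs = 0"
proof (induction xs arbitrary: n \<psi>)
  case Nil
  then show ?case by (simp add: act_zero)
next
  case (Cons x xs)
  have "\<theta> z (\<lambda>ys. \<psi> (x # ys)) xs = 0"
  proof (cases n)
    case 0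
    \<comment> \<open>No list starting with \<open>x\<close> has length 0, so the insertion vanishes
      identically.\<close>
    then have "(\<lambda>ys. \<psi> (x # ys)) = (\<lambda>ys. 0)" using Cons.prems by auto
    then show ?thesis by (simp add: theta_zero)
  next
    case (Suc m)
    show ?thesis by (rule Cons.IH[of m]) (use Suc Cons.prems in auto)
  qed
  with Cons.prems show ?case by simp
qed

lemma D_support:
  "\<lbrakk>\<And>xs. length xs \<noteq> n \<Longrightarrow> \<psi> xs = 0; length xs \<noteq> Suc n\<rbrakk> \<Longrightarrow> D \<psi> xs = 0"
proof (induction xs arbitrary: n \<psi>)
  case (Cons x xs)
  have "D (\<lambda>ys. \<psi> (x # ys)) xs = 0"
  proof (cases n)
    case 0
    then have "(\<lambda>ys. \<psi> (x # ys)) = (\<lambda>ys. 0)" using Cons.prems by auto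
    then show ?thesis by (simp add: D_zero)
  next
    case (Suc m)
    show ?thesis by (rule Cons.IH[of m]) (use Suc Cons.prems in auto)
  qed
  moreover have "\<theta> x \<psi> xs = 0" by (rule theta_support[of n]) (use Cons.prems in auto)
  ultimately show ?case by simp
qed simp

section \<open>Agreement with the explicit sums\<close>

lemma nths_Cons_omit:
  "nths (x # xs) (- {0}) = xs"
  "nths (x # xs) (- {Suc i}) = x # nths xs (- {i})"
  "nths (x # xs) (- {0, Suc i}) = nths xs (- {i})"
  "nths (x # xs) (- {Suc i, Suc j}) = x # nths xs (- {i, j})"
proof -
  have "{k. Suc k \<noteq> 0} = UNIV" by auto
  moreover have "{k. k \<noteq> i} = - {i}" "{k. k \<noteq> i \<and> k \<noteq> j} = - {i, j}" by auto
  moreover have "nths xs UNIV = xs" by (rule nths_all) simp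
  ultimately show "nths (x # xs) (- {0}) = xs"
    "nths (x # xs) (- {Suc i}) = x # nths xs (- {i})"
    "nths (x # xs) (- {0, Suc i}) = nths xs (- {i})"
    "nths (x # xs) (- {Suc i, Suc j}) = x # nths xs (- {i, j})"
    by (simp_all add: nths_Cons)
qed

text \<open>Position 0 contributes the bracket with \<open>x\<close>. In the other summands
  \<open>x\<close> stands in front of the bracket in the recursion but behind it in the sum, hence
  \<open>alt_swap\<close>.\<close>

lemma theta_eq_sum:
  "alt \<psi> \<Longrightarrow> \<theta> z \<psi> xs =
    act z (\<psi> xs) + (\<Sum>i<length xs. \<psi> (brk L z (xs ! i) # nths xs (- {i})))"
proof (induction xs arbitrary: \<psi>)
  case (Cons x xs)
  then show ?case
    by (simp add: alternating_contract sum.lessThan_Suc_shift nths_Cons_omit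
        alt_swap[OF Cons.prems, of x] ac_simps del: sum.lessThan_Suc)
qed simp

text \<open>The pairs containing position 0 and the action of the first entry form
  \<open>\<theta> x \<psi> xs\<close>; the remaining terms form \<open>D\<close> of the insertion of
  \<open>x\<close>.\<close>

lemma D_eq_sum:
  "alt \<psi> \<Longrightarrow> D \<psi> xs =
    (\<Sum>j<length xs. \<Sum>i<j. \<psi> (brk L (xs ! i) (xs ! j) # nths xs (- {i, j})))
    + (\<Sum>i<length xs. act (xs ! i) (\<psi> (nths xs (- {i}))))"
proof (induction xs arbitrary: \<psi>)
  case (Cons x xs)
  then show ?case
    by (simp add: alternating_contract sum.lessThan_Suc_shift nths_Cons_omit sum.distrib
        theta_eq_sum alt_swap[OF Cons.prems, of x] ac_simps del: sum.lessThan_Suc)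
qed simp

lemma alt_maps_iff_alt:
  "\<psi> \<in> alt_maps (scal L) s n \<longleftrightarrow> alt \<psi> \<and> (\<forall>xs. length xs \<noteq> n \<longrightarrow> \<psi> xs = 0)"
  by (rule alt_maps_iff) (rule vector_space_axioms V.vector_space_axioms)+

lemma d_CE_eq: "\<psi> \<in> alt_maps (scal L) s n \<Longrightarrow> d_CE L act n \<psi> = D \<psi>"
proof
  fix xs
  assume "\<psi> \<in> alt_maps (scal L) s n"
  then show "d_CE L act n \<psi> xs = D \<psi> xs"
    using D_support[of n \<psi> xs]
    by (cases "length xs = Suc n")
      (simp_all add: d_CE_def alt_maps_iff_alt D_eq_sum del: sum.lessThan_Suc)
qed

lemma alt_maps_D: "\<psi> \<in> alt_maps (scal L) s n \<Longrightarrow> D \<psi> \<in> alt_maps (scal L) s (Suc n)"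
  by (auto simp: alt_maps_iff_alt alt_D intro!: D_support[of n])

lemma alt_maps_theta: "\<psi> \<in> alt_maps (scal L) s n \<Longrightarrow> \<theta> z \<psi> \<in> alt_maps (scal L) s n"
  by (auto simp: alt_maps_iff_alt alt_theta intro!: theta_support[of n])

lemma alt_maps_contract:
  "\<psi> \<in> alt_maps (scal L) s (Suc n) \<Longrightarrow> (\<lambda>ys. \<psi> (z # ys)) \<in> alt_maps (scal L) s n"
  by (auto simp: alt_maps_iff_alt alternating_contract)

lemma alt_plus:
  assumes "alt f" "alt g"
  shows "alt (\<lambda>xs. f xs + g xs)"
  using assms linear_plus by (simp add: alternating_def)

lemma alt_maps_plus:
  "\<lbrakk>f \<in> alt_maps (scal L) s n; g \<in> alt_maps (scal L) s n\<rbrakk>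
    \<Longrightarrow> (\<lambda>xs. f xs + g xs) \<in> alt_maps (scal L) s n"
  by (simp add: alt_maps_iff_alt alt_plus)

lemma alt_maps_zero: "(\<lambda>xs. 0) \<in> alt_maps (scal L) s n"
  by (simp add: alt_maps_iff_alt alternating_def Vector_Spaces.linear_iff
      vector_space_axioms V.vector_space_axioms)

section \<open>The coboundary of restricted cochains\<close>

definition cartan_delta :: "('a, 'v) cochain \<Rightarrow> 'a \<Rightarrow> 'a list \<Rightarrow> 'v" where
  "cartan_delta = (\<lambda>(\<psi>, \<omega>) x zs. \<psi> (sq L x # zs) + \<theta> x (\<lambda>ys. \<psi> (x # ys)) zs + D (\<omega> x) zs)"

lemma cochains_alt: "(\<psi>, \<omega>) \<in> cochains L s n \<Longrightarrow> \<psi> \<in> alt_maps (scal L) s n"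
  by (auto simp: cochains_def split: if_splits)

text \<open>For \<open>n \<le> 1\<close> the truncated \<open>n - 2\<close> is 0, which does no harm
  because the second component is the zero map.\<close>

lemma cochains_alt_snd:
  "(\<psi>, \<omega>) \<in> cochains L s n \<Longrightarrow> \<omega> x \<in> alt_maps (scal L) s (n - 2)"
  using alt_maps_zero by (auto simp: cochains_def zero_fun_def split: if_splits)

text \<open>Both sides vanish on other lengths. Freed from the length condition, this law and
  \<open>cochains_add\<close> become equations of functions, to which \<open>D\<close> can be
  applied.\<close>

lemma cochains_scale:
  assumes "(\<psi>, \<omega>) \<in> cochains L s n"
  shows "\<omega> (scal L c x) zs = s (c\<^sup>2) (\<omega> x zs)"
  using assms cochains_alt_snd[OF assms]
  by (cases "length zs = n - 2") (auto simp: cochains_def alt_maps_iff_alt split: if_splits)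

lemma cochains_add:
  assumes "(\<psi>, \<omega>) \<in> cochains L s n"
  shows "\<omega> (x + y) zs = \<omega> x zs + \<omega> y zs + \<psi> (x # y # zs)"
  using assms cochains_alt_snd[OF assms] cochains_alt[OF assms]
  by (cases "length zs = n - 2"; cases "n \<le> 1") (auto simp: cochains_def alt_maps_iff_alt)

text \<open>The action of \<open>x\<close> and the brackets with \<open>x\<close> make up the Lie
  derivative of the insertion of \<open>x\<close>; the terms in \<open>\<omega>\<close> make up
  \<open>D (\<omega> x)\<close>.\<close>

lemma delta_eq:
  assumes "(\<psi>, \<omega>) \<in> cochains L s (Suc n)"
  shows "delta L act (Suc n) (\<psi>, \<omega>) = cartan_delta (\<psi>, \<omega>)"
proof (intro ext)
  fix x zs
  note psi = cochains_alt[OF assms] and om = cochains_alt_snd[OF assms, of x]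
  have a: "alt (\<lambda>ys. \<psi> (x # ys))" "alt (\<omega> x)"
    using psi om by (auto simp: alt_maps_iff_alt alternating_contract)
  show "delta L act (Suc n) (\<psi>, \<omega>) x zs = cartan_delta (\<psi>, \<omega>) x zs"
  proof (cases "length zs = n")
    case False
    have "\<theta> x (\<lambda>ys. \<psi> (x # ys)) zs = 0" 
      by (rule theta_support[of n]) (use False psi in \<open>auto simp: alt_maps_iff_alt\<close>)
    moreover have "\<psi> (sq L x # zs) = 0" using False psi by (auto simp: alt_maps_iff_alt)
    moreover have "D (\<omega> x) zs = 0"
    \<comment> \<open>In degree 1 the truncated bound \<open>n - 1 = 0\<close> would still admit
      length 1 in \<open>D_support\<close>; there \<open>\<omega> = 0\<close> settles it.\<close>
    proof (cases "n = 0")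
      case True
      then show ?thesis using assms by (simp add: cochains_def D_zero zero_fun_def)
    next
      case n: False
      show ?thesis by (rule D_support[of "n - 1"]) (use n False om in \<open>auto simp: alt_maps_iff_alt\<close>)
    qed
    ultimately show ?thesis using False by (simp add: delta_def cartan_delta_def)
  next
    case len: True
    show ?thesis
    proof (cases "n = 0")
      case True
      then show ?thesis using len assms
        by (simp add: delta_def cartan_delta_def cochains_def)
    next
      case False
      \<comment> \<open>\<open>theta_eq_sum\<close> yields the bracket behind \<open>x\<close>,
        whereas \<open>delta\<close> has it in front.\<close>
      have sw: "\<psi> (x # brk L x y # ys) = \<psi> (brk L x y # x # ys)" for y ys
        using psi alt_swap by (simp add: alt_maps_iff_alt)
      show ?thesis using len False
        by (simp add: delta_def cartan_delta_def theta_eq_sum[OF a(1)] D_eq_sum[OF a(2)] sw ac_simps)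
    qed
  qed
qed

lemma coboundary_cochains:
  assumes c: "(\<psi>, \<omega>) \<in> cochains L s n"
  shows "(d_CE L act n \<psi>, delta L act n (\<psi>, \<omega>)) \<in> cochains L s (Suc n)"
proof (cases n)
  case 0
  \<comment> \<open>The convention that \<open>delta\<close> is 0 for \<open>n = 0\<close> matches
    the second component 0 required in degree 1.\<close>
  then show ?thesis using alt_maps_D[OF cochains_alt[OF c]] d_CE_eq[OF cochains_alt[OF c]]
    by (simp add: cochains_def delta_def zero_fun_def)
next
  case (Suc m)
  note psi = cochains_alt[OF c] and om = cochains_alt_snd[OF c]
  have al: "alt \<psi>" using psi by (simp add: alt_maps_iff_alt)
  note alc = alternating_contract[OF al]
  have D_om: "D (\<omega> x) \<in> alt_maps (scal L) s m" for x
  proof (cases m)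
    case 0
    then have "\<omega> x = (\<lambda>ys. 0)" using c Suc by (simp add: cochains_def zero_fun_def)
    then show ?thesis using alt_maps_zero by (simp add: D_zero)
  next
    case (Suc k)
    then show ?thesis using om[of x] alt_maps_D[of "\<omega> x" k] \<open>n = Suc m\<close> by simp
  qed
  have "cartan_delta (\<psi>, \<omega>) x \<in> alt_maps (scal L) s m" for x
    using psi Suc D_om unfolding cartan_delta_def
    by (auto intro!: alt_maps_plus alt_maps_contract alt_maps_theta)
  \<comment> \<open>The factor \<open>c\<^sup>2\<close> comes from \<open>sq_scal\<close> in the
    first term and from the two occurrences of \<open>x\<close> in the second.\<close>
  moreover have "cartan_delta (\<psi>, \<omega>) (scal L c x) zs = s (c\<^sup>2) (cartan_delta (\<psi>, \<omega>) x zs)" for c x zs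
  proof -
    have "\<omega> (scal L c x) = (\<lambda>zs. s (c\<^sup>2) (\<omega> x zs))"
      using cochains_scale[OF assms] by blast
    then show ?thesis
      by (simp add: cartan_delta_def sq_scal alt_head[OF al] alc theta_scale_left theta_scale D_scale
          V.scale_right_distrib power2_eq_square)
  qed
  \<comment> \<open>The cross terms are \<open>\<psi>\<close> at \<open>brk L x y\<close>, the Lie
    derivative along either of \<open>x\<close>, \<open>y\<close> of the insertion of the other, and
    \<open>D\<close> of the double insertion: exactly \<open>D \<psi> (x # y # zs)\<close> expanded
    twice.\<close>
  moreover have "cartan_delta (\<psi>, \<omega>) (x + y) zs =
      cartan_delta (\<psi>, \<omega>) x zs + cartan_delta (\<psi>, \<omega>) y zs + D \<psi> (x # y # zs)" for x y zs
  proof -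
    have "\<omega> (x + y) = (\<lambda>zs. \<omega> x zs + \<omega> y zs + \<psi> (x # y # zs))"
      using cochains_add[OF assms] by blast
    then show ?thesis
      by (simp add: cartan_delta_def sq_add alt_head[OF al] alc theta_add_left theta_add D_add
          alternating_contract[OF alc] cancel_2 ac_simps)
  qed
  moreover have "delta L act n (\<psi>, \<omega>) = cartan_delta (\<psi>, \<omega>)"
    using c Suc delta_eq by simp
  ultimately show ?thesis
    using alt_maps_D[OF psi] unfolding d_CE_eq[OF psi]
    by (simp add: cochains_def Suc del: cartan_d.simps)
qed

lemma d_CE_d_CE:
  assumes c: "(\<psi>, \<omega>) \<in> cochains L s n"
  shows "d_CE L act (Suc n) (d_CE L act n \<psi>) = (\<lambda>xs. 0)"
proof -
  note psi = cochains_alt[OF c]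
  show ?thesis using psi by (auto simp: d_CE_eq[OF psi] d_CE_eq[OF alt_maps_D[OF psi]] D_D alt_maps_iff_alt)
qed

text \<open>Expand \<open>D \<psi>\<close> at \<open>sq L x\<close> and at \<open>x\<close> by
  Cartan's formula. Then \<open>\<theta> (sq L x) \<psi>\<close> cancels
  \<open>\<theta> x (\<theta> x \<psi>)\<close>, \<open>D\<close> of the insertion of
  \<open>sq L x\<close> occurs twice, \<open>D\<close> and \<open>\<theta> x\<close> commute on the
  insertion of \<open>x\<close>, and \<open>D (D (\<omega> x))\<close> is 0.\<close>

lemma delta_delta:
  assumes c: "(\<psi>, \<omega>) \<in> cochains L s n"
  shows "delta L act (Suc n) (d_CE L act n \<psi>, delta L act n (\<psi>, \<omega>)) = (\<lambda>x zs. 0)"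
proof -
  note psi = cochains_alt[OF c] and om = cochains_alt_snd[OF c]
  have al: "alt \<psi>" "alt (\<omega> x)" for x using psi om by (simp_all add: alt_maps_iff_alt)
  note alc = alternating_contract[OF al(1)]
  have eq: "delta L act (Suc n) (d_CE L act n \<psi>, delta L act n (\<psi>, \<omega>)) =
      cartan_delta (D \<psi>, delta L act n (\<psi>, \<omega>))"
    using delta_eq[OF coboundary_cochains[OF c]] by (simp only: d_CE_eq[OF psi])
  show ?thesis
  proof (cases n)
    case 0
    \<comment> \<open>Insertions into a map without arguments vanish, so only the pair from
      \<open>theta_theta\<close> is left.\<close>
    then have "\<psi> (x # ys) = 0" for x ys using psi by (auto simp: alt_maps_iff_alt)
    then show ?thesis unfolding eq using 0 
      by (simp add: cartan_delta_def theta_add theta_theta[OF al(1)] D_zero delta_def theta_zero cancel_2)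
  next
    case (Suc m)
    then show ?thesis unfolding eq using c
      by (simp add: delta_eq cartan_delta_def theta_add D_add D_D al alc theta_theta D_theta cancel_2 ac_simps)
  qed
qed

end

section \<open>Naturality in the coefficients and in the algebra\<close>

lemma linear_additive: "Vector_Spaces.linear s\<^sub>1 s\<^sub>2 f \<Longrightarrow> additive f"
  by (simp add: Vector_Spaces.linear_iff additive_def)

lemma d_CE_plus:
  assumes "\<And>x. additive (act x)"
  shows "d_CE L act n (\<lambda>xs. f xs + g xs) xs = d_CE L act n f xs + d_CE L act n g xs"
  by (simp add: d_CE_def additive.add[OF assms] sum.distrib ac_simps del: sum.lessThan_Suc)

lemma delta_plus:
  assumes "\<And>x. additive (act x)"
  shows "delta L act n (\<lambda>xs. f xs + g xs, \<lambda>x zs. F x zs + G x zs) x zs =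
    delta L act n (f, F) x zs + delta L act n (g, G) x zs"
  by (simp add: delta_def additive.add[OF assms] sum.distrib ac_simps)

lemma d_CE_compose:
  assumes "additive f" "\<And>x v. f (act x v) = act' x (f v)"
  shows "d_CE L act' n (\<lambda>xs. f (\<psi> xs)) xs = f (d_CE L act n \<psi> xs)"
  by (simp add: d_CE_def additive.add[OF assms(1)] additive.zero[OF assms(1)]
      additive.sum[OF assms(1)] assms(2) del: sum.lessThan_Suc)

lemma delta_compose:
  assumes "additive f" "\<And>x v. f (act x v) = act' x (f v)"
  shows "delta L act' n (\<lambda>xs. f (\<psi> xs), \<lambda>x zs. f (\<omega> x zs)) x zs = f (delta L act n (\<psi>, \<omega>) x zs)"
  by (simp add: delta_def additive.add[OF assms(1)] additive.zero[OF assms(1)]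
      additive.sum[OF assms(1)] assms(2))

lemma d_CE_pullback:
  assumes "\<And>x y. \<phi> (brk L x y) = brk M (\<phi> x) (\<phi> y)"
  shows "d_CE L (\<lambda>x. act (\<phi> x)) n (\<lambda>xs. \<nu> (map \<phi> xs)) xs = d_CE M act n \<nu> (map \<phi> xs)"
  by (auto simp: d_CE_def assms nths_map simp del: sum.lessThan_Suc
      intro!: sum.cong arg_cong2[of _ _ _ _ "(+)"])

lemma delta_pullback:
  assumes "\<And>x y. \<phi> (brk L x y) = brk M (\<phi> x) (\<phi> y)" "\<And>x. \<phi> (sq L x) = sq M (\<phi> x)"
  shows "delta L (\<lambda>x. act (\<phi> x)) n (\<lambda>xs. \<nu> (map \<phi> xs), \<lambda>x zs. \<epsilon> (\<phi> x) (map \<phi> zs)) x zs =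
    delta M act n (\<nu>, \<epsilon>) (\<phi> x) (map \<phi> zs)"
  by (auto simp: delta_def assms nths_map intro!: sum.cong arg_cong2[of _ _ _ _ "(+)"])

lemma alt_maps_compose:
  assumes "\<psi> \<in> alt_maps sL sV n" "Vector_Spaces.linear sV sW f"
  shows "(\<lambda>xs. f (\<psi> xs)) \<in> alt_maps sL sW n"
  using assms(1) additive.zero[OF linear_additive[OF assms(2)]]
    Vector_Spaces.linear_compose[OF _ assms(2), of sL]
  by (simp add: alt_maps_def o_def)

lemma alt_maps_pullback:
  assumes "\<nu> \<in> alt_maps sM sV n" "Vector_Spaces.linear sL sM \<phi>"
  shows "(\<lambda>xs. \<nu> (map \<phi> xs)) \<in> alt_maps sL sV n"
proof -
  have "Vector_Spaces.linear sL sV (\<lambda>y. \<nu> (map \<phi> (xs[i := y])))" if "length xs = n" "i < n" for xs i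
    using Vector_Spaces.linear_compose[OF assms(2), of sV "\<lambda>y. \<nu> ((map \<phi> xs)[i := y])"] assms(1) that
    by (simp add: alt_maps_def o_def map_update)
  then show ?thesis using assms(1) by (auto simp: alt_maps_def)
qed

lemma cochains_compose:
  assumes "(\<psi>, \<omega>) \<in> cochains L sV n" "Vector_Spaces.linear sV sW f"
  shows "(\<lambda>xs. f (\<psi> xs), \<lambda>x zs. f (\<omega> x zs)) \<in> cochains L sW n"
  using assms additive.zero[OF linear_additive[OF assms(2)]]
  by (auto simp: cochains_def alt_maps_compose[OF _ assms(2)] zero_fun_def
      Vector_Spaces.linear_iff split: if_splits)

lemma cochains_pullback:
  assumes "(\<nu>, \<epsilon>) \<in> cochains M sV n" "Vector_Spaces.linear (scal L) (scal M) \<phi>"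
  shows "(\<lambda>xs. \<nu> (map \<phi> xs), \<lambda>x zs. \<epsilon> (\<phi> x) (map \<phi> zs)) \<in> cochains L sV n"
  using assms
  by (auto simp: cochains_def alt_maps_pullback[OF _ assms(2)] zero_fun_def
      Vector_Spaces.linear_iff split: if_splits)

lemma (in restricted_module_char_2) cochains_plus:
  assumes "(f, F) \<in> cochains L s n" "(g, G) \<in> cochains L s n"
  shows "(\<lambda>xs. f xs + g xs, \<lambda>x zs. F x zs + G x zs) \<in> cochains L s n"
  using assms
  by (auto simp: cochains_def alt_maps_plus zero_fun_def V.scale_right_distrib ac_simps split: if_splits)

section \<open>The deformation complex as a mapping cone\<close>

theorem theorem4p22:
  fixes L :: "('k::field, 'a::ab_group_add) restricted_lie"
    and M :: "('k, 'b::ab_group_add) restricted_lie"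
    and \<phi> :: "'a \<Rightarrow> 'b"
  assumes "CHAR('k) = 2"
    and "restricted_lie_algebra L"
    and "restricted_lie_algebra M"
    and "restricted_morphism L M \<phi>"
  shows "\<forall>n. (\<forall>c \<in> def_cochains L M n. def_diff L M \<phi> n c \<in> def_cochains L M (n + 1))
    \<and> (\<forall>c \<in> def_cochains L M n. def_diff L M \<phi> (n + 1) (def_diff L M \<phi> n c) = 0)"
proof -
  interpret restricted_morphism L M \<phi> by fact
  interpret LL: restricted_module_char_2 L "scal L" "brk L"
    using restricted_module_adjoint[OF assms(1,2)] assms(1)
    by (simp add: restricted_module_char_2_def restricted_module_char_2_axioms_def)
  interpret MM: restricted_module_char_2 M "scal M" "brk M"
    using restricted_module_adjoint[OF assms(1,3)] assms(1)
    by (simp add: restricted_module_char_2_def restricted_module_char_2_axioms_def)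
  interpret LM: restricted_module_char_2 L "scal M" "pullback_action M \<phi>"
    using restricted_module_pullback[OF assms(1,4)] assms(1)
    by (simp add: restricted_module_char_2_def restricted_module_char_2_axioms_def)
  let ?act = "pullback_action M \<phi>"
  have act: "additive (?act x)" for x by (simp add: additive_def LM.act_add)
  have pull: "?act = (\<lambda>x. brk M (\<phi> x))" by (simp add: pullback_action_def fun_eq_iff)
  have phi: "additive \<phi>" by (rule linear_additive[OF morphism_linear])
  \<comment> \<open>\<open>\<phi>\<close> is a module map from the adjoint module of
    \<open>L\<close>, so composition with it commutes with the coboundaries.\<close>
  have phi_act: "\<phi> (brk L x v) = ?act x (\<phi> v)" for x v
    by (simp add: pullback_action_def morphism_brk)
  \<comment> \<open>Degree 0 is set apart, because there the complex is zero instead of a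
    product.\<close>
  have closed: "def_diff L M \<phi> n c \<in> def_cochains L M (n + 1)"
    and square: "def_diff L M \<phi> (n + 1) (def_diff L M \<phi> n c) = 0"
    if c: "c \<in> def_cochains L M n" "n > 0" for n c
  proof -
    obtain m where n: "n = Suc m" using \<open>n > 0\<close> by (cases n) auto
    obtain \<mu> \<omega> \<nu> \<epsilon> \<theta> \<rho> where c_eq: "c = ((\<mu>, \<omega>), (\<nu>, \<epsilon>), (\<theta>, \<rho>))"
      by (metis prod.exhaust)
    have mu: "(\<mu>, \<omega>) \<in> cochains L (scal L) n" and nu: "(\<nu>, \<epsilon>) \<in> cochains M (scal M) n"
      and th: "(\<theta>, \<rho>) \<in> cochains L (scal M) m"
      using c by (auto simp: def_cochains_def c_eq n)
    define \<alpha> where "\<alpha> = def_alpha L M \<phi> n \<mu> \<nu> \<theta>"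
    define \<beta> where "\<beta> = def_beta L M \<phi> n \<omega> \<epsilon> (\<theta>, \<rho>)"
    have alpha: "\<alpha> = (\<lambda>xs. \<phi> (\<mu> xs) + \<nu> (map \<phi> xs) + d_CE L ?act m \<theta> xs)"
      by (simp add: \<alpha>_def n def_alpha_def fun_eq_iff)
    have beta: "\<beta> = (\<lambda>x zs. \<phi> (\<omega> x zs) + \<epsilon> (\<phi> x) (map \<phi> zs) + delta L ?act m (\<theta>, \<rho>) x zs)"
      by (simp add: \<beta>_def n def_beta_def fun_eq_iff)
    \<comment> \<open>Three cochains are added: \<open>(\<mu>, \<omega>)\<close> composed with
      \<open>\<phi>\<close>, \<open>(\<nu>, \<epsilon>)\<close> pulled back along
      \<open>\<phi>\<close>, and the coboundary of \<open>(\<theta>, \<rho>)\<close>.\<close>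
    have ab: "(\<alpha>, \<beta>) \<in> cochains L (scal M) n"
      unfolding alpha beta n
      using mu nu th unfolding n
      by (intro LM.cochains_plus cochains_compose[OF _ morphism_linear]
          cochains_pullback[OF _ morphism_linear] LM.coboundary_cochains)
    \<comment> \<open>This absorbs the case distinction for \<open>n = 1\<close> in
      \<open>def_diff\<close>.\<close>
    then have "n = 1 \<Longrightarrow> \<beta> = 0" by (simp add: cochains_def)
    then have diff: "def_diff L M \<phi> n c =
      ((d_CE L (brk L) n \<mu>, delta L (brk L) n (\<mu>, \<omega>)),
       (d_CE M (brk M) n \<nu>, delta M (brk M) n (\<nu>, \<epsilon>)), (\<alpha>, \<beta>))"
      using n by (auto simp: def_diff_def c_eq \<alpha>_def \<beta>_def)
    show "def_diff L M \<phi> n c \<in> def_cochains L M (n + 1)"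
      using ab LL.coboundary_cochains[OF mu] MM.coboundary_cochains[OF nu]
      by (simp add: diff def_cochains_def)
    \<comment> \<open>The coboundary of the third summand vanishes; naturality moves the coboundary
      through the other two.\<close>
    have "d_CE L ?act n \<alpha> xs = \<phi> (d_CE L (brk L) n \<mu> xs) + d_CE M (brk M) n \<nu> (map \<phi> xs)" for xs
      using d_CE_pullback[of \<phi> L M "brk M" n \<nu> xs, OF morphism_brk] LM.d_CE_d_CE[OF th]
      by (simp add: alpha d_CE_plus[OF act] d_CE_compose[of \<phi> "brk L" ?act, OF phi phi_act] n flip: pull)
    moreover have "delta L ?act n (\<alpha>, \<beta>) x zs =
      \<phi> (delta L (brk L) n (\<mu>, \<omega>) x zs) + delta M (brk M) n (\<nu>, \<epsilon>) (\<phi> x) (map \<phi> zs)" for x zs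
      using delta_pullback[of \<phi> L M "brk M" n \<nu> \<epsilon> x zs, OF morphism_brk morphism_sq] LM.delta_delta[OF th]
      by (simp add: alpha beta delta_plus[OF act] delta_compose[of \<phi> "brk L" ?act, OF phi phi_act] n flip: pull)
    \<comment> \<open>The next \<open>def_alpha\<close> and \<open>def_beta\<close> add the same two
      terms once more, so everything cancels in pairs.\<close>
    ultimately have "def_alpha L M \<phi> (n + 1) (d_CE L (brk L) n \<mu>) (d_CE M (brk M) n \<nu>) \<alpha> = 0"
      and "def_beta L M \<phi> (n + 1) (delta L (brk L) n (\<mu>, \<omega>)) (delta M (brk M) n (\<nu>, \<epsilon>)) (\<alpha>, \<beta>) = 0"
      by (auto simp: def_alpha_def def_beta_def fun_eq_iff MM.cancel_2 ac_simps)
    then show "def_diff L M \<phi> (n + 1) (def_diff L M \<phi> n c) = 0"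
      using LL.d_CE_d_CE[OF mu] MM.d_CE_d_CE[OF nu] LL.delta_delta[OF mu] MM.delta_delta[OF nu]
        \<open>n > 0\<close>
      unfolding diff by (simp add: def_diff_def zero_prod_def zero_fun_def)
  qed
  \<comment> \<open>For \<open>n = 0\<close> the differential is constantly 0; it remains to place 0
    in degree 1 and to see that the next differential kills it.\<close>
  have zero: "0 \<in> def_cochains L M 1"
    using LL.alt_maps_zero[of 1] MM.alt_maps_zero[of 1] LM.alt_maps_zero[of 0]
    by (simp add: def_cochains_def cochains_def zero_prod_def zero_fun_def)
  have diff_zero: "def_diff L M \<phi> 0 c = 0" for c
    by (auto simp: def_diff_def split: prod.splits)
  have "def_diff L M \<phi> 1 0 = 0"
    by (auto simp: def_diff_def zero_prod_def zero_fun_def d_CE_def delta_def def_alpha_def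
        LL.act_zero MM.act_zero LM.act_zero additive.zero[OF phi] fun_eq_iff)
  then show ?thesis using closed square zero diff_zero
    by (metis add_0 gr0I)
qed

end
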